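(* Let $M_P=\langle M,P(M)\rangle$ be a small model of $T^2$ satisfying the Density Property (for $\mathcal L$-1-types): for every very small $A\subset M$ and every $q\in S^1_1(A)$ with $q\downarrow_{P(A)}A$, $q$ is realized in $P(M)$. Then $M_P$ satisfies the Density Property for $\mathcal L$-types of very small length: for every very small $A\subset M$ and every complete $\mathcal L$-type $q$ over $A$ in a very small tuple of variables with $q\downarrow_{P(A)}A$, $q$ is realized by a tuple of elements of $P(M)$.
   Context: $T$ is a complete first-order theory in a language $\mathcal L$ and $\mathfrak C$ is a monster model of $T$; "small" means of cardinality smaller than the monstrosity of $\mathfrak C$ (its degree of saturation and strong homogeneity); tuples have small length. Juxtaposition denotes union, and tuples are identified with their sets of entries. An independence relation on $\mathfrak C$ is a ternary relation $A\downarrow_C B$ on small subsets of $\mathfrak C$ such that for all small $A,B,C,D$: (Invariance) $A\downarrow_B C\Rightarrow\sigma(A)\downarrow_{\sigma(B)}\sigma(C)$ for $\sigma\in\mathrm{Aut}(\mathfrak C)$; (Normality) $A\downarrow_C B\Rightarrow AC\downarrow_C B$; (Symmetry) $A\downarrow_B C\Rightarrow C\downarrow_B A$; (Transitivity) if $B\subseteq C\subseteq D$, then $A\downarrow_B D$ iff $A\downarrow_B C$ and $A\downarrow_C D$; (Finite character) $A\downarrow_B C$ iff $A_0\downarrow_B C$ for all finite $A_0\subseteq A$; (Extension) there is $A'\equiv_B A$ with $A'\downarrow_B C$; (Local character) there is a small cardinal $\lambda$ depending only on $\downarrow$ such that for all small $A,C$ there is $C_0\subseteq C$ with $|C_0|<\lambda+|A|^+$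 and $A\downarrow_{C_0}C$. Fix an independence relation $\downarrow$ on $\mathfrak C$. $\kappa_0$ is the least regular cardinal $\mu$ such that for every finite tuple $\bar a$ and small set $B$ there is $B_0\subseteq B$ with $|B_0|<\mu$ and $\bar a\downarrow_{B_0}B$. $\mathcal L^2=\mathcal L\cup\{P\}$ with $P$ a new unary predicate; $T^2$ is the theory of all expansions of $T$ to $\mathcal L^2$. A superscript 1 on a model-theoretic notion refers to $\mathcal L$; $S^1_1(A)$ is the set of complete $\mathcal L$-types over $A$ in one variable. Models of $T$ are elementary substructures of $\mathfrak C$; a model of $T^2$ is written $M_P=\langle M,P(M)\rangle$, and $P(A)=P(M)\cap A$ for $A\subseteq M$. For a complete type $q$ over $A\supseteq B$, $q\downarrow_B A$ means $c\downarrow_B A$ for a realization $c$ of $q$ in $\mathfrak C$. Fix a small cardinal $\kappa>\max(\kappa_0,|T|)$; a set or tuple is very small if its cardinality is $<\kappa$. *)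

theory Defs
  imports Main
begin

unbundle cardinal_syntax

section \<open>First-order logic with equality\<close>

text \<open>A language is given by two partial arity functions; its function and relation symbols are
  their domains, and constants are function symbols of arity 0. The equality symbol is logical.\<close>

record ('f, 'r) language =
  fun_arity :: "'f \<Rightarrow> nat option"
  rel_arity :: "'r \<Rightarrow> nat option"

datatype ('f, 'v) tm = Var 'v | Fn 'f "('f, 'v) tm list"

datatype ('f, 'r, 'v) fm =
    Eq "('f, 'v) tm" "('f, 'v) tm"
  | Rel 'r "('f, 'v) tm list"
  | Neg "('f, 'r, 'v) fm"
  | Conj "('f, 'r, 'v) fm" "('f, 'r, 'v) fm"
  | Ex 'v "('f, 'r, 'v) fm"

fun tm_vars :: "('f, 'v) tm \<Rightarrow> 'v set" where
  "tm_vars (Var x) = {x}"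
| "tm_vars (Fn f ts) = (\<Union>t\<in>set ts. tm_vars t)"

fun fm_vars :: "('f, 'r, 'v) fm \<Rightarrow> 'v set" where
  "fm_vars (Eq s t) = tm_vars s \<union> tm_vars t"
| "fm_vars (Rel r ts) = (\<Union>t\<in>set ts. tm_vars t)"
| "fm_vars (Neg \<phi>) = fm_vars \<phi>"
| "fm_vars (Conj \<phi> \<psi>) = fm_vars \<phi> \<union> fm_vars \<psi>"
| "fm_vars (Ex x \<phi>) = fm_vars \<phi> - {x}"

fun wf_tm :: "('f, 'r) language \<Rightarrow> ('f, 'v) tm \<Rightarrow> bool" where
  "wf_tm L (Var x) \<longleftrightarrow> True"
| "wf_tm L (Fn f ts) \<longleftrightarrow> fun_arity L f = Some (length ts) \<and> (\<forall>t\<in>set ts. wf_tm L t)"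

fun wf_fm :: "('f, 'r) language \<Rightarrow> ('f, 'r, 'v) fm \<Rightarrow> bool" where
  "wf_fm L (Eq s t) \<longleftrightarrow> wf_tm L s \<and> wf_tm L t"
| "wf_fm L (Rel r ts) \<longleftrightarrow> rel_arity L r = Some (length ts) \<and> (\<forall>t\<in>set ts. wf_tm L t)"
| "wf_fm L (Neg \<phi>) \<longleftrightarrow> wf_fm L \<phi>"
| "wf_fm L (Conj \<phi> \<psi>) \<longleftrightarrow> wf_fm L \<phi> \<and> wf_fm L \<psi>"
| "wf_fm L (Ex x \<phi>) \<longleftrightarrow> wf_fm L \<phi>"

definition formulas :: "('f, 'r) language \<Rightarrow> 'v set \<Rightarrow> ('f, 'r, 'v) fm set" where
  "formulas L X = {\<phi>. wf_fm L \<phi> \<and> fm_vars \<phi> \<subseteq> X}"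

abbreviation sentences :: "('f, 'r) language \<Rightarrow> ('f, 'r, 'v) fm set" where
  "sentences L \<equiv> formulas L {}"

record ('f, 'r, 'a) struct =
  carrier :: "'a set"
  fn :: "'f \<Rightarrow> 'a list \<Rightarrow> 'a"
  rl :: "'r \<Rightarrow> 'a list \<Rightarrow> bool"

definition is_struct :: "('f, 'r) language \<Rightarrow> ('f, 'r, 'a) struct \<Rightarrow> bool" where
  "is_struct L M \<longleftrightarrow> carrier M \<noteq> {} \<and>
     (\<forall>f xs. fun_arity L f = Some (length xs) \<longrightarrow> set xs \<subseteq> carrier M \<longrightarrow> fn M f xs \<in> carrier M)"

fun tm_val :: "('f, 'r, 'a) struct \<Rightarrow> ('v \<Rightarrow> 'a) \<Rightarrow> ('f, 'v) tm \<Rightarrow> 'a" where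
  "tm_val M e (Var x) = e x"
| "tm_val M e (Fn f ts) = fn M f (map (tm_val M e) ts)"

fun sat :: "('f, 'r, 'a) struct \<Rightarrow> ('v \<Rightarrow> 'a) \<Rightarrow> ('f, 'r, 'v) fm \<Rightarrow> bool" where
  "sat M e (Eq s t) \<longleftrightarrow> tm_val M e s = tm_val M e t"
| "sat M e (Rel r ts) \<longleftrightarrow> rl M r (map (tm_val M e) ts)"
| "sat M e (Neg \<phi>) \<longleftrightarrow> \<not> sat M e \<phi>"
| "sat M e (Conj \<phi> \<psi>) \<longleftrightarrow> sat M e \<phi> \<and> sat M e \<psi>"
| "sat M e (Ex x \<phi>) \<longleftrightarrow> (\<exists>a\<in>carrier M. sat M (e(x := a)) \<phi>)"

definition models :: "('f, 'r, 'a) struct \<Rightarrow> ('f, 'r, 'v) fm set \<Rightarrow> bool" where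
  "models M T \<longleftrightarrow> (\<forall>\<phi>\<in>T. \<forall>e. range e \<subseteq> carrier M \<longrightarrow> sat M e \<phi>)"

text \<open>A complete theory is a deductively closed one, so that its cardinality is the usual
  \<open>|T| = |L| + \<aleph>\<^sub>0\<close>. Its consistency is not part of this definition: it is guaranteed by
  the monster model.\<close>

definition complete_theory :: "('f, 'r) language \<Rightarrow> ('f, 'r, nat) fm set \<Rightarrow> bool" where
  "complete_theory L T \<longleftrightarrow> T \<subseteq> sentences L \<and> (\<forall>\<phi>\<in>sentences L. \<phi> \<in> T \<or> Neg \<phi> \<in> T)"

definition elem_substruct ::
  "('f, 'r) language \<Rightarrow> ('f, 'r, 'a) struct \<Rightarrow> ('f, 'r, 'a) struct \<Rightarrow> bool" where
  "elem_substruct L M N \<longleftrightarrow> is_struct L M \<and> carrier M \<subseteq> carrier N \<and>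
     (\<forall>f xs. fun_arity L f = Some (length xs) \<longrightarrow> set xs \<subseteq> carrier M \<longrightarrow> fn M f xs = fn N f xs) \<and>
     (\<forall>r xs. rel_arity L r = Some (length xs) \<longrightarrow> set xs \<subseteq> carrier M \<longrightarrow> rl M r xs = rl N r xs) \<and>
     (\<forall>(\<phi> :: ('f, 'r, nat) fm) e. wf_fm L \<phi> \<longrightarrow> range e \<subseteq> carrier M \<longrightarrow> sat M e \<phi> = sat N e \<phi>)"

definition Aut :: "('f, 'r) language \<Rightarrow> ('f, 'r, 'a) struct \<Rightarrow> ('a \<Rightarrow> 'a) set" where
  "Aut L M = {\<sigma>. bij_betw \<sigma> (carrier M) (carrier M) \<and>
     (\<forall>f xs. fun_arity L f = Some (length xs) \<longrightarrow> set xs \<subseteq> carrier M \<longrightarrow>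
        \<sigma> (fn M f xs) = fn M f (map \<sigma> xs)) \<and>
     (\<forall>r xs. rel_arity L r = Some (length xs) \<longrightarrow> set xs \<subseteq> carrier M \<longrightarrow>
        rl M r xs = rl M r (map \<sigma> xs))}"

section \<open>Types over parameter sets\<close>

text \<open>\<open>L(A)\<close> adds a constant \<open>Inr a\<close> for every \<open>a \<in> A\<close>; it names \<open>a\<close>.\<close>

definition param_lang :: "('f, 'r) language \<Rightarrow> 'a set \<Rightarrow> ('f + 'a, 'r) language" where
  "param_lang L A = \<lparr>fun_arity = case_sum (fun_arity L) (\<lambda>a. if a \<in> A then Some 0 else None),
                     rel_arity = rel_arity L\<rparr>"

definition param_struct :: "('f, 'r, 'a) struct \<Rightarrow> ('f + 'a, 'r, 'a) struct" where
  "param_struct M = \<lparr>carrier = carrier M, fn = case_sum (fn M) (\<lambda>a xs. a), rl = rl M\<rparr>"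

text \<open>A tuple of variables is a family \<open>(Inr i)\<close> indexed by a set \<open>I\<close> of any type; the variables
  \<open>Inl n\<close> are an extra supply for quantification. Correspondingly, a tuple of elements is a
  function on the index type of which only the values on \<open>I\<close> matter.\<close>

type_synonym ('f, 'r, 'a, 'i) pfm = "('f + 'a, 'r, nat + 'i) fm"

definition tuple_formulas ::
  "('f, 'r) language \<Rightarrow> 'a set \<Rightarrow> 'i set \<Rightarrow> ('f, 'r, 'a, 'i) pfm set" where
  "tuple_formulas L A I = formulas (param_lang L A) (Inr ` I)"

text \<open>The values given to the variables \<open>Inl n\<close> are irrelevant, as they never occur free in
  a member of \<^const>\<open>tuple_formulas\<close>.\<close>

definition holds_at :: "('f, 'r, 'a) struct \<Rightarrow> ('i \<Rightarrow> 'a) \<Rightarrow> ('f, 'r, 'a, 'i) pfm \<Rightarrow> bool" where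
  "holds_at M c \<phi> \<longleftrightarrow> sat (param_struct M) (case_sum (\<lambda>_. undefined) c) \<phi>"

definition tp :: "('f, 'r) language \<Rightarrow> ('f, 'r, 'a) struct \<Rightarrow> 'a set \<Rightarrow> 'i set \<Rightarrow> ('i \<Rightarrow> 'a)
    \<Rightarrow> ('f, 'r, 'a, 'i) pfm set" where
  "tp L M A I c = {\<phi> \<in> tuple_formulas L A I. holds_at M c \<phi>}"

definition realizes ::
  "('f, 'r, 'a) struct \<Rightarrow> 'i set \<Rightarrow> ('i \<Rightarrow> 'a) \<Rightarrow> ('f, 'r, 'a, 'i) pfm set \<Rightarrow> bool" where
  "realizes M I c q \<longleftrightarrow> c ` I \<subseteq> carrier M \<and> (\<forall>\<phi>\<in>q. holds_at M c \<phi>)"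

text \<open>Complete types over \<open>A\<close> (with respect to the ambient structure) in the variables indexed
  by \<open>I\<close>: finitely satisfiable, and containing each formula or its negation.\<close>

definition complete_types :: "('f, 'r) language \<Rightarrow> ('f, 'r, 'a) struct \<Rightarrow> 'a set \<Rightarrow> 'i set
    \<Rightarrow> ('f, 'r, 'a, 'i) pfm set set" where
  "complete_types L M A I = {q. q \<subseteq> tuple_formulas L A I \<and>
     (\<forall>\<phi>\<in>tuple_formulas L A I. \<phi> \<in> q \<or> Neg \<phi> \<in> q) \<and>
     (\<forall>q0. q0 \<subseteq> q \<longrightarrow> finite q0 \<longrightarrow> (\<exists>c. realizes M I c q0))}"

text \<open>\<open>A' \<equiv>\<^sub>B A\<close> for sets: \<open>A\<close>, enumerated by itself, and some enumeration of \<open>A'\<close> along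
  \<open>A\<close> have the same type over \<open>B\<close>.\<close>

definition equiv_over ::
  "('f, 'r) language \<Rightarrow> ('f, 'r, 'a) struct \<Rightarrow> 'a set \<Rightarrow> 'a set \<Rightarrow> 'a set \<Rightarrow> bool" where
  "equiv_over L M B A' A \<longleftrightarrow> (\<exists>f. f ` A = A' \<and> tp L M B A f = tp L M B A id)"

section \<open>The monster model and independence relations\<close>

text \<open>Cardinals are represented by well-orders, as usual in HOL; \<open>\<chi>\<close> is the monstrosity.\<close>

definition small :: "('f, 'r, 'a) struct \<Rightarrow> 'm rel \<Rightarrow> 'a set \<Rightarrow> bool" where
  "small C \<chi> A \<longleftrightarrow> A \<subseteq> carrier C \<and> |A| <o \<chi>"

definition saturated :: "('f, 'r) language \<Rightarrow> ('f, 'r, 'a) struct \<Rightarrow> 'm rel \<Rightarrow> bool" where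
  "saturated L C \<chi> \<longleftrightarrow>
     (\<forall>A. small C \<chi> A \<longrightarrow>
        (\<forall>q\<in>complete_types L C A (UNIV :: unit set). \<exists>c. realizes C UNIV c q))"

definition strongly_homogeneous ::
  "('f, 'r) language \<Rightarrow> ('f, 'r, 'a) struct \<Rightarrow> 'm rel \<Rightarrow> bool" where
  "strongly_homogeneous L C \<chi> \<longleftrightarrow>
     (\<forall>A f. small C \<chi> A \<longrightarrow> f ` A \<subseteq> carrier C \<longrightarrow> tp L C {} A f = tp L C {} A id \<longrightarrow>
        (\<exists>\<sigma>\<in>Aut L C. \<forall>a\<in>A. \<sigma> a = f a))"

definition monster_model ::
  "('f, 'r) language \<Rightarrow> ('f, 'r, nat) fm set \<Rightarrow> ('f, 'r, 'a) struct \<Rightarrow> 'm rel \<Rightarrow> bool" where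
  "monster_model L T C \<chi> \<longleftrightarrow> is_struct L C \<and> models C T \<and> Cinfinite \<chi> \<and>
     saturated L C \<chi> \<and> strongly_homogeneous L C \<chi>"

text \<open>\<open>ind A B C\<close> stands for \<open>A \<down>\<^sub>B C\<close>: the base is the middle argument. Its values on
  triples of sets that are not all small play no role. In the last clause it is enough to let
  \<open>\<nu>\<close> range over cardinals on the type of \<open>\<chi>\<close>, since \<open>\<nu> < \<chi>\<close>.\<close>

definition independence_relation :: "('f, 'r) language \<Rightarrow> ('f, 'r, 'a) struct \<Rightarrow> 'm rel
    \<Rightarrow> ('a set \<Rightarrow> 'a set \<Rightarrow> 'a set \<Rightarrow> bool) \<Rightarrow> bool" where
  "independence_relation L C \<chi> ind \<longleftrightarrow>
     \<comment> \<open>invariance\<close>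
     (\<forall>A B D. small C \<chi> A \<longrightarrow> small C \<chi> B \<longrightarrow> small C \<chi> D \<longrightarrow> ind A B D \<longrightarrow>
        (\<forall>\<sigma>\<in>Aut L C. ind (\<sigma> ` A) (\<sigma> ` B) (\<sigma> ` D))) \<and>
     \<comment> \<open>normality\<close>
     (\<forall>A B D. small C \<chi> A \<longrightarrow> small C \<chi> B \<longrightarrow> small C \<chi> D \<longrightarrow> ind A B D \<longrightarrow> ind (A \<union> B) B D) \<and>
     \<comment> \<open>symmetry\<close>
     (\<forall>A B D. small C \<chi> A \<longrightarrow> small C \<chi> B \<longrightarrow> small C \<chi> D \<longrightarrow> ind A B D \<longrightarrow> ind D B A) \<and>
     \<comment> \<open>transitivity\<close>
     (\<forall>A B D E. small C \<chi> A \<longrightarrow> small C \<chi> B \<longrightarrow> small C \<chi> D \<longrightarrow> small C \<chi> E \<longrightarrow>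
        B \<subseteq> D \<longrightarrow> D \<subseteq> E \<longrightarrow> (ind A B E \<longleftrightarrow> ind A B D \<and> ind A D E)) \<and>
     \<comment> \<open>finite character\<close>
     (\<forall>A B D. small C \<chi> A \<longrightarrow> small C \<chi> B \<longrightarrow> small C \<chi> D \<longrightarrow>
        (ind A B D \<longleftrightarrow> (\<forall>A0. A0 \<subseteq> A \<longrightarrow> finite A0 \<longrightarrow> ind A0 B D))) \<and>
     \<comment> \<open>extension\<close>
     (\<forall>A B D. small C \<chi> A \<longrightarrow> small C \<chi> B \<longrightarrow> small C \<chi> D \<longrightarrow>
        (\<exists>A'. small C \<chi> A' \<and> equiv_over L C B A' A \<and> ind A' B D)) \<and>
     \<comment> \<open>local character\<close>
     (\<exists>\<nu> :: 'm rel. Card_order \<nu> \<and> \<nu> <o \<chi> \<and>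
        (\<forall>A D. small C \<chi> A \<longrightarrow> small C \<chi> D \<longrightarrow>
           (\<exists>D0. D0 \<subseteq> D \<and> |D0| <o \<nu> +c cardSuc |A| \<and> ind A D0 D)))"

definition finite_local_bound :: "('f, 'r, 'a) struct \<Rightarrow> 'm rel
    \<Rightarrow> ('a set \<Rightarrow> 'a set \<Rightarrow> 'a set \<Rightarrow> bool) \<Rightarrow> 'k rel \<Rightarrow> bool" where
  "finite_local_bound C \<chi> ind \<mu> \<longleftrightarrow>
     (\<forall>A B. finite A \<longrightarrow> A \<subseteq> carrier C \<longrightarrow> small C \<chi> B \<longrightarrow>
        (\<exists>B0. B0 \<subseteq> B \<and> |B0| <o \<mu> \<and> ind A B0 B))"

text \<open>Minimality among the cardinals on the type of \<open>\<kappa>\<^sub>0\<close> is minimality among all cardinals,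
  since every cardinal below \<open>\<kappa>\<^sub>0\<close> is isomorphic to one on that type.\<close>

definition is_kappa0 :: "('f, 'r, 'a) struct \<Rightarrow> 'm rel
    \<Rightarrow> ('a set \<Rightarrow> 'a set \<Rightarrow> 'a set \<Rightarrow> bool) \<Rightarrow> 'k rel \<Rightarrow> bool" where
  "is_kappa0 C \<chi> ind \<kappa>\<^sub>0 \<longleftrightarrow>
     Cinfinite \<kappa>\<^sub>0 \<and> regularCard \<kappa>\<^sub>0 \<and> finite_local_bound C \<chi> ind \<kappa>\<^sub>0 \<and>
     (\<forall>\<mu> :: 'k rel. Cinfinite \<mu> \<longrightarrow> regularCard \<mu> \<longrightarrow> finite_local_bound C \<chi> ind \<mu> \<longrightarrow> \<kappa>\<^sub>0 \<le>o \<mu>)"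

text \<open>\<open>q \<down>\<^sub>B A\<close> for a complete type \<open>q\<close> over \<open>A\<close>. For small \<open>A\<close> and \<open>I\<close>, any two realizations of
  \<open>q\<close> are conjugate over \<open>A\<close>, so by invariance the choice of realization does not matter.\<close>

definition type_ind :: "('f, 'r, 'a) struct \<Rightarrow> ('a set \<Rightarrow> 'a set \<Rightarrow> 'a set \<Rightarrow> bool)
    \<Rightarrow> 'i set \<Rightarrow> ('f, 'r, 'a, 'i) pfm set \<Rightarrow> 'a set \<Rightarrow> 'a set \<Rightarrow> bool" where
  "type_ind C ind I q B A \<longleftrightarrow> (\<exists>c. realizes C I c q \<and> ind (c ` I) B A)"

section \<open>Expansions by a unary predicate\<close>

text \<open>The new predicate symbol \<open>P\<close> is \<^const>\<open>None\<close>.\<close>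

definition lang2 :: "('f, 'r) language \<Rightarrow> ('f, 'r option) language" where
  "lang2 L = \<lparr>fun_arity = fun_arity L, rel_arity = case_option (Some 1) (rel_arity L)\<rparr>"

definition reduct :: "('f, 'r option, 'a) struct \<Rightarrow> ('f, 'r, 'a) struct" where
  "reduct M = \<lparr>carrier = carrier M, fn = fn M, rl = (\<lambda>r. rl M (Some r))\<rparr>"

definition P_of :: "('f, 'r option, 'a) struct \<Rightarrow> 'a set" where
  "P_of M = {x \<in> carrier M. rl M None [x]}"

text \<open>The \<open>L\<^sup>2\<close>-sentences true in all expansions of models of \<open>T\<close>. The expansions range over
  structures on a given type \<open>'a\<close>; by the downward Loewenheim-Skolem theorem this loses nothing
  when \<open>'a\<close> is the type of a monster model of monstrosity greater than \<open>|T|\<close>.\<close>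

definition theory2 :: "'a itself \<Rightarrow> ('f, 'r) language \<Rightarrow> ('f, 'r, nat) fm set
    \<Rightarrow> ('f, 'r option, nat) fm set" where
  "theory2 _ L T = {\<phi> \<in> sentences (lang2 L).
     \<forall>N :: ('f, 'r option, 'a) struct.
       is_struct (lang2 L) N \<longrightarrow> models (reduct N) T \<longrightarrow> models N {\<phi>}}"

text \<open>Models of \<open>T\<^sup>2\<close>, with the convention that models of \<open>T\<close> are elementary substructures
  of the monster model \<open>C\<close>.\<close>

definition model2 :: "('f, 'r) language \<Rightarrow> ('f, 'r, nat) fm set \<Rightarrow> ('f, 'r, 'a) struct
    \<Rightarrow> ('f, 'r option, 'a) struct \<Rightarrow> bool" where
  "model2 L T C MP \<longleftrightarrow> is_struct (lang2 L) MP \<and> models MP (theory2 TYPE('a) L T) \<and>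
     elem_substruct L (reduct MP) C"

text \<open>The Density Property for complete \<open>L\<close>-types in the variables indexed by \<open>I\<close>.\<close>

definition density_property :: "('f, 'r) language \<Rightarrow> ('f, 'r, 'a) struct
    \<Rightarrow> ('a set \<Rightarrow> 'a set \<Rightarrow> 'a set \<Rightarrow> bool) \<Rightarrow> 'k rel \<Rightarrow> ('f, 'r option, 'a) struct \<Rightarrow> 'i set \<Rightarrow> bool"
  where
  "density_property L C ind \<kappa> MP I \<longleftrightarrow>
     (\<forall>A q. A \<subseteq> carrier MP \<longrightarrow> |A| <o \<kappa> \<longrightarrow> q \<in> complete_types L C A I \<longrightarrow>
        type_ind C ind I q (P_of MP \<inter> A) A \<longrightarrow>
        (\<exists>c. c ` I \<subseteq> P_of MP \<and> realizes C I c q))"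

end

theory Submission
  imports Defs
begin

text \<open>
  Let \<open>c\<close> realize \<open>q\<close> with \<open>c \<down> A\<close> over \<open>P(A)\<close>. Well-order the index set and choose
  \<open>b\<^sub>i \<in> P(M)\<close> by recursion so that the families of the \<open>b\<^sub>j\<close> and of the \<open>c\<^sub>j\<close> with \<open>j \<le> i\<close> have
  the same type over \<open>A\<close>. At stage \<open>i\<close> write \<open>b'\<close> and \<open>c'\<close> for the families of the \<open>b\<^sub>j\<close> and of
  the \<open>c\<^sub>j\<close> with \<open>j < i\<close>. These have the same type over \<open>A\<close>, because a formula has finitely many
  free variables (\<open>tp_eq_finitary\<close>); so some automorphism \<open>\<sigma>\<close> over \<open>A\<close> takes \<open>c'\<close> to \<open>b'\<close>
  (\<open>monster_conjugate\<close>). Put \<open>d = \<sigma> c\<^sub>i\<close>. By invariance \<open>b'd \<down> A\<close> over \<open>P(A)\<close>, and symmetry,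
  normality and transitivity turn this into \<open>d \<down> Ab'\<close> over \<open>P(A)b'\<close> (\<open>ind_move_to_base\<close>). Since
  \<open>b'\<close> lies in \<open>P(M)\<close>, that base is \<open>P(Ab')\<close>; and \<open>Ab'\<close> is very small, having at most
  \<open>|A| + |I| < \<kappa>\<close> elements. So the density property in one variable gives \<open>b\<^sub>i \<in> P(M)\<close> with the
  type of \<open>d\<close> over \<open>Ab'\<close>, and then \<open>b'b\<^sub>i\<close>, \<open>b'd\<close> and \<open>c'c\<^sub>i\<close> have the same type over \<open>A\<close>
  (\<open>density_extend\<close>).

  Passing between a type over \<open>Ab'\<close> and a type over \<open>A\<close> in more variables, or between a type
  over \<open>A\<close> and one over the empty set, means exchanging parameters for variables. All such
  exchanges are instances of \<open>tp_eq_transfer\<close>, which rests on a capture-avoiding substitution.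
\<close>

section \<open>Evaluation of terms and formulas\<close>

lemma tm_val_cong:
  "(\<And>x. x \<in> tm_vars s \<Longrightarrow> e x = e' x) \<Longrightarrow> tm_val M e s = tm_val M e' s"
proof (induction s)
  case (Fn f ts)
  have "map (tm_val M e) ts = map (tm_val M e') ts"
    using Fn by (intro map_cong) auto
  then show ?case by (simp only: tm_val.simps)
qed simp

lemma sat_cong:
  "(\<And>x. x \<in> fm_vars \<phi> \<Longrightarrow> e x = e' x) \<Longrightarrow> sat M e \<phi> = sat M e' \<phi>"
proof (induction \<phi> arbitrary: e e')
  case (Eq s t)
  then have "tm_val M e s = tm_val M e' s" "tm_val M e t = tm_val M e' t"
    by (auto intro!: tm_val_cong)
  then show ?case by simp
next
  case (Rel r ts)
  then have "map (tm_val M e) ts = map (tm_val M e') ts"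
    by (auto intro!: tm_val_cong)
  then show ?case by (simp only: sat.simps)
next
  case (Neg \<phi>)
  from Neg.IH[of e e'] Neg.prems show ?case by simp
next
  case (Conj \<phi> \<psi>)
  from Conj.IH(1)[of e e'] Conj.IH(2)[of e e'] Conj.prems show ?case by simp
next
  case (Ex x \<phi>)
  have "sat M (e(x := a)) \<phi> = sat M (e'(x := a)) \<phi>" for a
    using Ex.prems by (intro Ex.IH) auto
  then show ?case by simp
qed

lemma finite_tm_vars: "finite (tm_vars s)"
  by (induction s) auto

lemma finite_fm_vars: "finite (fm_vars \<phi>)"
  by (induction \<phi>) (auto simp: finite_tm_vars)

lemma holds_at_cong:
  assumes "\<phi> \<in> tuple_formulas L A I" "\<And>i. i \<in> I \<Longrightarrow> x i = y i"
  shows "holds_at M x \<phi> = holds_at M y \<phi>"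
  unfolding holds_at_def
  using assms by (intro sat_cong) (auto simp: tuple_formulas_def formulas_def)

lemma tp_cong:
  assumes "\<And>i. i \<in> I \<Longrightarrow> x i = y i"
  shows "tp L M A I x = tp L M A I y"
  unfolding tp_def using assms holds_at_cong[of _ L A I x y M] by blast

lemma tp_eq_iff:
  "tp L M A I x = tp L M A I y \<longleftrightarrow> (\<forall>\<phi>\<in>tuple_formulas L A I. holds_at M x \<phi> = holds_at M y \<phi>)"
  unfolding tp_def by blast

lemma tuple_formulas_mono: "K \<subseteq> I \<Longrightarrow> tuple_formulas L A K \<subseteq> tuple_formulas L A I"
  unfolding tuple_formulas_def formulas_def by blast

lemma tp_eq_mono:
  "tp L M A I x = tp L M A I y \<Longrightarrow> K \<subseteq> I \<Longrightarrow> tp L M A K x = tp L M A K y"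
  unfolding tp_eq_iff using tuple_formulas_mono by blast

lemma tp_eq_finitary:
  assumes "\<And>K. K \<subseteq> I \<Longrightarrow> finite K \<Longrightarrow> tp L M A K x = tp L M A K y"
  shows "tp L M A I x = tp L M A I y"
  unfolding tp_eq_iff
proof
  fix \<phi> assume \<phi>: "\<phi> \<in> tuple_formulas L A I"
  define K where "K = {i. Inr i \<in> fm_vars \<phi>}"
  have "finite K"
    unfolding K_def using finite_vimageI[OF finite_fm_vars, of Inr \<phi>] by (simp add: vimage_def)
  moreover have "K \<subseteq> I" "\<phi> \<in> tuple_formulas L A K"
    using \<phi> by (auto simp: K_def tuple_formulas_def formulas_def)
  ultimately show "holds_at M x \<phi> = holds_at M y \<phi>"
    using assms[of K] by (simp add: tp_eq_iff)
qed

section \<open>Capture-avoiding substitution\<close>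

text \<open>An element of \<open>'a + 'j\<close> stands for the name of a parameter or for a free variable, and
  \<open>sym_tm\<close> is the corresponding term; under a tuple \<open>y\<close> its value is given by
  \<^term>\<open>case_sum id y\<close>.\<close>

definition sym_tm :: "'a + 'j \<Rightarrow> ('f + 'a, nat + 'j) tm" where
  "sym_tm = case_sum (\<lambda>a. Fn (Inr a) []) (\<lambda>j. Var (Inr j))"

text \<open>Simultaneous substitution of \<open>sym_tm (t a)\<close> for the name of each parameter \<open>a\<close> and of the
  term \<open>\<rho> x\<close> for each free variable \<open>x\<close>.\<close>

fun subst_tm :: "('a \<Rightarrow> 'a + 'j) \<Rightarrow> ('v \<Rightarrow> ('f + 'a, nat + 'j) tm) \<Rightarrow> ('f + 'a, 'v) tm
    \<Rightarrow> ('f + 'a, nat + 'j) tm" where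
  "subst_tm t \<rho> (Var x) = \<rho> x"
| "subst_tm t \<rho> (Fn f ts) =
     (case f of Inl g \<Rightarrow> Fn (Inl g) (map (subst_tm t \<rho>) ts) | Inr a \<Rightarrow> sym_tm (t a))"

text \<open>Capture is avoided by renaming each bound variable to \<open>Inl n\<close>, where \<open>n\<close> counts the
  enclosing quantifiers.\<close>

fun subst_fm :: "('a \<Rightarrow> 'a + 'j) \<Rightarrow> ('v \<Rightarrow> ('f + 'a, nat + 'j) tm) \<Rightarrow> nat
    \<Rightarrow> ('f + 'a, 'r, 'v) fm \<Rightarrow> ('f + 'a, 'r, nat + 'j) fm" where
  "subst_fm t \<rho> n (Eq s u) = Eq (subst_tm t \<rho> s) (subst_tm t \<rho> u)"
| "subst_fm t \<rho> n (Rel r ts) = Rel r (map (subst_tm t \<rho>) ts)"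
| "subst_fm t \<rho> n (Neg \<phi>) = Neg (subst_fm t \<rho> n \<phi>)"
| "subst_fm t \<rho> n (Conj \<phi> \<psi>) = Conj (subst_fm t \<rho> n \<phi>) (subst_fm t \<rho> n \<psi>)"
| "subst_fm t \<rho> n (Ex x \<phi>) = Ex (Inl n) (subst_fm t (\<rho>(x := Var (Inl n))) (Suc n) \<phi>)"

lemma tm_val_sym_tm:
  assumes "\<And>j. e (Inr j) = y j"
  shows "tm_val (param_struct M) e (sym_tm u) = case_sum id y u"
  using assms by (cases u) (auto simp: sym_tm_def param_struct_def)

lemma tm_val_subst_tm:
  assumes "wf_tm (param_lang L A) s"
    and "\<And>a. a \<in> A \<Longrightarrow> case_sum id y (t a) = a"
    and "\<And>j. e (Inr j) = y j"
  shows "tm_val (param_struct M) e (subst_tm t \<rho> s)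
       = tm_val (param_struct M) (\<lambda>x. tm_val (param_struct M) e (\<rho> x)) s"
  using assms(1)
proof (induction s)
  case (Fn f ts)
  show ?case
  proof (cases f)
    case (Inl g)
    have "map (\<lambda>s. tm_val (param_struct M) e (subst_tm t \<rho> s)) ts
        = map (tm_val (param_struct M) (\<lambda>x. tm_val (param_struct M) e (\<rho> x))) ts"
      using Fn by (intro map_cong) auto
    then show ?thesis
      using Inl by (simp only: subst_tm.simps sum.case tm_val.simps list.map_comp comp_def)
  next
    case (Inr a)
    then have "a \<in> A" using Fn.prems by (auto simp: param_lang_def split: if_splits)
    then show ?thesis
      using Inr assms(2) tm_val_sym_tm[of e y M "t a"] assms(3) by (simp add: param_struct_def)
  qed
qed simp

text \<open>The last hypothesis says that the terms put for free variables do not mention the variables \<open>Inl n\<close>,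
  \<open>Inl (n + 1)\<close>, and so on, that the substitution is going to bind.\<close>

lemma sat_subst_fm:
  assumes "wf_fm (param_lang L A) \<phi>"
    and t: "\<And>a. a \<in> A \<Longrightarrow> case_sum id y (t a) = a"
    and "\<And>j. e (Inr j) = y j"
    and "\<And>x m. x \<in> fm_vars \<phi> \<Longrightarrow> Inl m \<in> tm_vars (\<rho> x) \<Longrightarrow> m < n"
  shows "sat (param_struct M) e (subst_fm t \<rho> n \<phi>)
       = sat (param_struct M) (\<lambda>x. tm_val (param_struct M) e (\<rho> x)) \<phi>"
  using assms(1,3,4)
proof (induction \<phi> arbitrary: e \<rho> n)
  case (Eq s u)
  then show ?case using tm_val_subst_tm[of L A _ y t e M \<rho>] t by simp
next
  case (Rel r ts)
  have "map (\<lambda>s. tm_val (param_struct M) e (subst_tm t \<rho> s)) ts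
      = map (tm_val (param_struct M) (\<lambda>x. tm_val (param_struct M) e (\<rho> x))) ts"
    using Rel t by (intro map_cong refl tm_val_subst_tm[where A = A and L = L and y = y]) auto
  then show ?case by (simp only: subst_fm.simps sat.simps list.map_comp comp_def)
next
  case (Neg \<phi>)
  have "sat (param_struct M) e (subst_fm t \<rho> n \<phi>)
      = sat (param_struct M) (\<lambda>x. tm_val (param_struct M) e (\<rho> x)) \<phi>"
    using Neg.prems by (intro Neg.IH) auto
  then show ?case by simp
next
  case (Conj \<phi> \<psi>)
  have "sat (param_struct M) e (subst_fm t \<rho> n \<phi>)
      = sat (param_struct M) (\<lambda>x. tm_val (param_struct M) e (\<rho> x)) \<phi>"
    using Conj.prems by (intro Conj.IH(1)) auto
  moreover have "sat (param_struct M) e (subst_fm t \<rho> n \<psi>)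
      = sat (param_struct M) (\<lambda>x. tm_val (param_struct M) e (\<rho> x)) \<psi>"
    using Conj.prems by (intro Conj.IH(2)) auto
  ultimately show ?case by simp
next
  case (Ex x \<phi>)
  let ?\<rho> = "\<rho>(x := Var (Inl n))"
  have "sat (param_struct M) (e(Inl n := a)) (subst_fm t ?\<rho> (Suc n) \<phi>)
      = sat (param_struct M) ((\<lambda>v. tm_val (param_struct M) e (\<rho> v))(x := a)) \<phi>" for a
  proof -
    have "sat (param_struct M) (e(Inl n := a)) (subst_fm t ?\<rho> (Suc n) \<phi>)
        = sat (param_struct M) (\<lambda>v. tm_val (param_struct M) (e(Inl n := a)) (?\<rho> v)) \<phi>"
    proof (rule Ex.IH)
      show "wf_fm (param_lang L A) \<phi>" using Ex.prems by simp
      show "(e(Inl n := a)) (Inr j) = y j" for j using Ex.prems by simp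
      show "m < Suc n" if "v \<in> fm_vars \<phi>" "Inl m \<in> tm_vars (?\<rho> v)" for v m
        using Ex.prems(3)[of v m] that by (cases "v = x") auto
    qed
    also have "\<dots> = sat (param_struct M) ((\<lambda>v. tm_val (param_struct M) e (\<rho> v))(x := a)) \<phi>"
    proof (rule sat_cong)
      fix v assume "v \<in> fm_vars \<phi>"
      then have "Inl n \<notin> tm_vars (\<rho> v)" if "v \<noteq> x"
        using Ex.prems(3)[of v n] that by auto
      then show "tm_val (param_struct M) (e(Inl n := a)) (?\<rho> v)
          = ((\<lambda>v. tm_val (param_struct M) e (\<rho> v))(x := a)) v"
        by (cases "v = x") (auto intro!: tm_val_cong)
    qed
    finally show ?thesis .
  qed
  then show ?case by simp
qed

lemma sym_tm_wf:
  "u \<in> A <+> J \<Longrightarrow> wf_tm (param_lang L A) (sym_tm u) \<and> tm_vars (sym_tm u) \<subseteq> Inr ` J"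
  by (auto simp: sym_tm_def param_lang_def)

lemma subst_tm_wf:
  assumes "wf_tm (param_lang L A) s"
    and "\<And>a. a \<in> A \<Longrightarrow> t a \<in> A' <+> J"
    and "\<And>x. x \<in> tm_vars s \<Longrightarrow> wf_tm (param_lang L A') (\<rho> x) \<and> tm_vars (\<rho> x) \<subseteq> Inr ` J \<union> V"
  shows "wf_tm (param_lang L A') (subst_tm t \<rho> s) \<and> tm_vars (subst_tm t \<rho> s) \<subseteq> Inr ` J \<union> V"
  using assms(1,3)
proof (induction s)
  case (Fn f ts)
  show ?case
  proof (cases f)
    case (Inl g)
    have "wf_tm (param_lang L A') (subst_tm t \<rho> s) \<and> tm_vars (subst_tm t \<rho> s) \<subseteq> Inr ` J \<union> V"
      if "s \<in> set ts" for s
      using Fn.prems that by (intro Fn.IH) auto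
    then show ?thesis using Inl Fn.prems by (auto simp: param_lang_def)
  next
    case (Inr a)
    then have "a \<in> A" using Fn.prems by (auto simp: param_lang_def split: if_splits)
    then have "t a \<in> A' <+> J" by (rule assms(2))
    from sym_tm_wf[OF this, of L] show ?thesis using Inr by auto
  qed
qed simp

lemma subst_fm_wf:
  assumes "wf_fm (param_lang L A) \<phi>"
    and t: "\<And>a. a \<in> A \<Longrightarrow> t a \<in> A' <+> J"
    and "\<And>x. x \<in> fm_vars \<phi> \<Longrightarrow>
      wf_tm (param_lang L A') (\<rho> x) \<and> tm_vars (\<rho> x) \<subseteq> Inr ` J \<union> Inl ` {..<n}"
  shows "wf_fm (param_lang L A') (subst_fm t \<rho> n \<phi>)
       \<and> fm_vars (subst_fm t \<rho> n \<phi>) \<subseteq> Inr ` J \<union> Inl ` {..<n}"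
  using assms(1,3)
proof (induction \<phi> arbitrary: \<rho> n)
  case (Eq s u)
  then show ?case
    using subst_tm_wf[of L A s t A' J \<rho> "Inl ` {..<n}"]
      subst_tm_wf[of L A u t A' J \<rho> "Inl ` {..<n}"] t by simp
next
  case (Rel r ts)
  have "wf_tm (param_lang L A') (subst_tm t \<rho> s)
      \<and> tm_vars (subst_tm t \<rho> s) \<subseteq> Inr ` J \<union> Inl ` {..<n}" if "s \<in> set ts" for s
    using Rel.prems that t by (intro subst_tm_wf) auto
  then show ?case using Rel.prems(1) by (auto simp: param_lang_def)
next
  case (Neg \<phi>)
  from Neg.IH[of \<rho> n] Neg.prems show ?case by simp
next
  case (Conj \<phi> \<psi>)
  from Conj.IH(1)[of \<rho> n] Conj.IH(2)[of \<rho> n] Conj.prems show ?case by simp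
next
  case (Ex x \<phi>)
  let ?\<rho> = "\<rho>(x := Var (Inl n))"
  have "wf_fm (param_lang L A') (subst_fm t ?\<rho> (Suc n) \<phi>)
      \<and> fm_vars (subst_fm t ?\<rho> (Suc n) \<phi>) \<subseteq> Inr ` J \<union> Inl ` {..<Suc n}"
  proof (rule Ex.IH)
    show "wf_fm (param_lang L A) \<phi>" using Ex.prems by simp
    fix v assume "v \<in> fm_vars \<phi>"
    then show "wf_tm (param_lang L A') (?\<rho> v)
        \<and> tm_vars (?\<rho> v) \<subseteq> Inr ` J \<union> Inl ` {..<Suc n}"
      using Ex.prems(2)[of v] by (cases "v = x") (auto simp: less_Suc_eq)
  qed
  then show ?case unfolding lessThan_Suc image_insert by auto
qed

text \<open>The type of a tuple determines the type of every tuple whose entries are chosen, by \<open>r\<close>,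
  among the parameters and the entries of the first one. The base may change as well, from \<open>A'\<close>
  to \<open>A\<close>, as long as \<open>t\<close> finds the elements of \<open>A\<close> among the parameters and the entries.\<close>

lemma tp_eq_transfer:
  fixes L :: "('f, 'r) language" and M :: "('f, 'r, 'a) struct"
    and x y :: "'j \<Rightarrow> 'a" and r :: "'i \<Rightarrow> 'a + 'j" and t :: "'a \<Rightarrow> 'a + 'j"
  assumes eq: "tp L M A' J x = tp L M A' J y"
    and r: "\<And>i. i \<in> I \<Longrightarrow> r i \<in> A' <+> J"
    and t: "\<And>a. a \<in> A \<Longrightarrow> t a \<in> A' <+> J"
    and tx: "\<And>a. a \<in> A \<Longrightarrow> case_sum id x (t a) = a"
    and ty: "\<And>a. a \<in> A \<Longrightarrow> case_sum id y (t a) = a"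
  shows "tp L M A I (\<lambda>i. case_sum id x (r i)) = tp L M A I (\<lambda>i. case_sum id y (r i))"
  unfolding tp_eq_iff
proof
  fix \<phi> :: "('f, 'r, 'a, 'i) pfm" assume "\<phi> \<in> tuple_formulas L A I"
  then have wf: "wf_fm (param_lang L A) \<phi>" and fv: "fm_vars \<phi> \<subseteq> Inr ` I"
    by (auto simp: tuple_formulas_def formulas_def)
  define \<rho> :: "nat + 'i \<Rightarrow> ('f + 'a, nat + 'j) tm" where "\<rho> = case_sum (\<lambda>n. Var (Inl n)) (\<lambda>i. sym_tm (r i))"
  define \<psi> where "\<psi> = subst_fm t \<rho> 0 \<phi>"
  have \<rho>: "wf_tm (param_lang L A') (\<rho> v) \<and> tm_vars (\<rho> v) \<subseteq> Inr ` J" if "v \<in> fm_vars \<phi>" for v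
    using that fv sym_tm_wf[OF r] by (fastforce simp: \<rho>_def)
  have "\<psi> \<in> tuple_formulas L A' J"
    using subst_fm_wf[OF wf t, where \<rho> = \<rho> and n = 0] \<rho> by (simp add: \<psi>_def tuple_formulas_def formulas_def)
  with eq have "holds_at M x \<psi> = holds_at M y \<psi>" by (simp add: tp_eq_iff)
  moreover have "holds_at M z \<psi> = holds_at M (\<lambda>i. case_sum id z (r i)) \<phi>"
    if z: "\<And>a. a \<in> A \<Longrightarrow> case_sum id z (t a) = a" for z
  proof -
    let ?e = "case_sum (\<lambda>_. undefined) z"
    have "holds_at M z \<psi> = sat (param_struct M) (\<lambda>v. tm_val (param_struct M) ?e (\<rho> v)) \<phi>"
      unfolding holds_at_def \<psi>_def
      by (rule sat_subst_fm[OF wf z]) (use \<rho> in fastforce)+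
    also have "\<dots> = holds_at M (\<lambda>i. case_sum id z (r i)) \<phi>"
      unfolding holds_at_def
    proof (rule sat_cong)
      fix v assume "v \<in> fm_vars \<phi>"
      then obtain i where "v = Inr i" using fv by blast
      then show "tm_val (param_struct M) ?e (\<rho> v)
          = case_sum (\<lambda>_. undefined) (\<lambda>i. case_sum id z (r i)) v"
        using tm_val_sym_tm[of ?e z M "r i"] by (simp add: \<rho>_def)
    qed
    finally show ?thesis .
  qed
  ultimately show "holds_at M (\<lambda>i. case_sum id x (r i)) \<phi> = holds_at M (\<lambda>i. case_sum id y (r i)) \<phi>"
    using tx ty by blast
qed

lemma tp_eq_same_equalities:
  assumes eq: "tp L M A J x = tp L M A J y" and "u \<in> A <+> J" "v \<in> A <+> J"
    and "case_sum id x u = case_sum id x v"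
  shows "case_sum id y u = case_sum id y v"
proof -
  let ?\<phi> = "Eq (sym_tm u) (sym_tm v)"
  have "?\<phi> \<in> tuple_formulas L A J"
    using sym_tm_wf[OF assms(2), of L] sym_tm_wf[OF assms(3), of L]
    by (auto simp: tuple_formulas_def formulas_def)
  with eq have "holds_at M x ?\<phi> = holds_at M y ?\<phi>" by (simp add: tp_eq_iff)
  moreover have "holds_at M z ?\<phi> \<longleftrightarrow> case_sum id z u = case_sum id z v" for z
    using tm_val_sym_tm[of "case_sum (\<lambda>_. undefined) z" z M] by (simp add: holds_at_def)
  ultimately show ?thesis using assms(4) by blast
qed

section \<open>Automorphisms and types\<close>

lemma tm_val_Aut:
  assumes "is_struct L M" "\<sigma> \<in> Aut L M" "A \<subseteq> carrier M" "\<And>a. a \<in> A \<Longrightarrow> \<sigma> a = a"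
    and "wf_tm (param_lang L A) s" "\<And>x. x \<in> tm_vars s \<Longrightarrow> e x \<in> carrier M"
  shows "tm_val (param_struct M) e s \<in> carrier M
       \<and> tm_val (param_struct M) (\<lambda>x. \<sigma> (e x)) s = \<sigma> (tm_val (param_struct M) e s)"
  using assms(5,6)
proof (induction s)
  case (Fn f ts)
  let ?xs = "map (tm_val (param_struct M) e) ts"
  have IH: "tm_val (param_struct M) e s \<in> carrier M
       \<and> tm_val (param_struct M) (\<lambda>x. \<sigma> (e x)) s = \<sigma> (tm_val (param_struct M) e s)"
    if "s \<in> set ts" for s
    using Fn.prems that by (intro Fn.IH) auto
  then have carr: "set ?xs \<subseteq> carrier M"
    and map: "map (tm_val (param_struct M) (\<lambda>x. \<sigma> (e x))) ts = map \<sigma> ?xs"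
    by auto
  show ?case
  proof (cases f)
    case (Inl g)
    then have ar: "fun_arity L g = Some (length ?xs)"
      using Fn.prems(1) by (simp add: param_lang_def)
    have "fn M g ?xs \<in> carrier M" using assms(1) ar carr unfolding is_struct_def by blast
    moreover have "\<sigma> (fn M g ?xs) = fn M g (map \<sigma> ?xs)"
      using assms(2) ar carr unfolding Aut_def by blast
    moreover have "fn (param_struct M) f = fn M g" using Inl by (simp add: param_struct_def)
    ultimately show ?thesis by (simp only: tm_val.simps map)
  next
    case (Inr a)
    then have "a \<in> A" using Fn.prems by (auto simp: param_lang_def split: if_splits)
    then show ?thesis using Inr assms(3,4) by (auto simp: param_struct_def)
  qed
qed simp

lemma sat_Aut:
  assumes "is_struct L M" "\<sigma> \<in> Aut L M" "A \<subseteq> carrier M" "\<And>a. a \<in> A \<Longrightarrow> \<sigma> a = a"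
    and "wf_fm (param_lang L A) \<phi>" "\<And>x. x \<in> fm_vars \<phi> \<Longrightarrow> e x \<in> carrier M"
  shows "sat (param_struct M) (\<lambda>x. \<sigma> (e x)) \<phi> = sat (param_struct M) e \<phi>"
  using assms(5,6)
proof (induction \<phi> arbitrary: e)
  case (Eq s u)
  have "inj_on \<sigma> (carrier M)" using assms(2) by (auto simp: Aut_def bij_betw_def)
  moreover note tm_val_Aut[OF assms(1-4), of s e] tm_val_Aut[OF assms(1-4), of u e]
  ultimately show ?case using Eq by (simp add: inj_on_eq_iff)
next
  case (Rel r ts)
  let ?xs = "map (tm_val (param_struct M) e) ts"
  have "tm_val (param_struct M) e s \<in> carrier M
       \<and> tm_val (param_struct M) (\<lambda>x. \<sigma> (e x)) s = \<sigma> (tm_val (param_struct M) e s)"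
    if "s \<in> set ts" for s
    using Rel.prems that by (intro tm_val_Aut[OF assms(1-4)]) auto
  then have carr: "set ?xs \<subseteq> carrier M"
    and map: "map (tm_val (param_struct M) (\<lambda>x. \<sigma> (e x))) ts = map \<sigma> ?xs"
    by auto
  have ar: "rel_arity L r = Some (length ?xs)"
    using Rel.prems(1) by (simp add: param_lang_def)
  have "rl M r ?xs = rl M r (map \<sigma> ?xs)"
    using assms(2) ar carr unfolding Aut_def by blast
  moreover have "rl (param_struct M) r = rl M r" by (simp add: param_struct_def)
  ultimately show ?case by (simp only: sat.simps map)
next
  case (Neg \<phi>)
  from Neg.IH[of e] Neg.prems show ?case by simp
next
  case (Conj \<phi> \<psi>)
  from Conj.IH(1)[of e] Conj.IH(2)[of e] Conj.prems show ?case by simp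
next
  case (Ex x \<phi>)
  have IH: "sat (param_struct M) ((\<lambda>v. \<sigma> (e v))(x := \<sigma> a)) \<phi> = sat (param_struct M) (e(x := a)) \<phi>"
    if "a \<in> carrier M" for a
  proof -
    have "sat (param_struct M) (\<lambda>v. \<sigma> ((e(x := a)) v)) \<phi> = sat (param_struct M) (e(x := a)) \<phi>"
      using Ex.prems that by (intro Ex.IH) auto
    moreover have "(\<lambda>v. \<sigma> ((e(x := a)) v)) = (\<lambda>v. \<sigma> (e v))(x := \<sigma> a)" by auto
    ultimately show ?thesis by simp
  qed
  have "\<sigma> ` carrier M = carrier M" using assms(2) by (auto simp: Aut_def bij_betw_def)
  then have "(\<exists>b\<in>carrier M. sat (param_struct M) ((\<lambda>v. \<sigma> (e v))(x := b)) \<phi>)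
      \<longleftrightarrow> (\<exists>a\<in>carrier M. sat (param_struct M) ((\<lambda>v. \<sigma> (e v))(x := \<sigma> a)) \<phi>)"
    by (metis (no_types, lifting) image_iff)
  also have "\<dots> \<longleftrightarrow> (\<exists>a\<in>carrier M. sat (param_struct M) (e(x := a)) \<phi>)"
    using IH by blast
  finally show ?case by (simp add: param_struct_def)
qed

lemma tp_Aut:
  assumes "is_struct L M" "\<sigma> \<in> Aut L M" "A \<subseteq> carrier M" "\<And>a. a \<in> A \<Longrightarrow> \<sigma> a = a"
    and "x ` I \<subseteq> carrier M"
  shows "tp L M A I (\<lambda>i. \<sigma> (x i)) = tp L M A I x"
  unfolding tp_eq_iff
proof
  fix \<phi> assume "\<phi> \<in> tuple_formulas L A I"
  then have wf: "wf_fm (param_lang L A) \<phi>" and fv: "fm_vars \<phi> \<subseteq> Inr ` I"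
    by (auto simp: tuple_formulas_def formulas_def)
  let ?e = "case_sum (\<lambda>_. undefined) x"
  have "sat (param_struct M) (\<lambda>v. \<sigma> (?e v)) \<phi> = sat (param_struct M) ?e \<phi>"
    using fv assms(5) by (intro sat_Aut[OF assms(1-4) wf]) fastforce+
  moreover have "holds_at M (\<lambda>i. \<sigma> (x i)) \<phi> = sat (param_struct M) (\<lambda>v. \<sigma> (?e v)) \<phi>"
    unfolding holds_at_def using fv by (intro sat_cong) auto
  ultimately show "holds_at M (\<lambda>i. \<sigma> (x i)) \<phi> = holds_at M x \<phi>"
    by (simp add: holds_at_def)
qed

lemma tp_in_complete_types:
  assumes "x ` I \<subseteq> carrier M"
  shows "tp L M A I x \<in> complete_types L M A I"
proof -
  have "realizes M I x q" if "q \<subseteq> tp L M A I x" for q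
    using assms that by (auto simp: realizes_def tp_def)
  moreover have "Neg \<phi> \<in> tuple_formulas L A I \<and> holds_at M x (Neg \<phi>) = (\<not> holds_at M x \<phi>)"
    if "\<phi> \<in> tuple_formulas L A I" for \<phi>
    using that by (simp add: tuple_formulas_def formulas_def holds_at_def)
  ultimately show ?thesis unfolding complete_types_def tp_def by blast
qed

lemma complete_type_eq_tp:
  assumes q: "q \<in> complete_types L M A I" and "realizes M I x q"
  shows "q = tp L M A I x"
proof
  show "q \<subseteq> tp L M A I x"
    using assms by (auto simp: complete_types_def realizes_def tp_def)
  show "tp L M A I x \<subseteq> q"
  proof
    fix \<phi> assume \<phi>: "\<phi> \<in> tp L M A I x"
    then have "\<phi> \<in> q \<or> Neg \<phi> \<in> q" using q by (auto simp: complete_types_def tp_def)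
    moreover have "Neg \<phi> \<notin> q"
      using \<phi> assms(2) by (auto simp: realizes_def tp_def holds_at_def)
    ultimately show "\<phi> \<in> q" by blast
  qed
qed

lemma realizes_tp_iff:
  "realizes M I y (tp L M A I x) \<longleftrightarrow> y ` I \<subseteq> carrier M \<and> tp L M A I y = tp L M A I x"
proof
  assume *: "realizes M I y (tp L M A I x)"
  have "holds_at M y \<phi> = holds_at M x \<phi>" if \<phi>: "\<phi> \<in> tuple_formulas L A I" for \<phi>
  proof (cases "holds_at M x \<phi>")
    case True
    then show ?thesis using * \<phi> by (auto simp: realizes_def tp_def)
  next
    case False
    then have "Neg \<phi> \<in> tp L M A I x"
      using \<phi> by (auto simp: tp_def tuple_formulas_def formulas_def holds_at_def)
    then show ?thesis using * False by (auto simp: realizes_def holds_at_def)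
  qed
  with * show "y ` I \<subseteq> carrier M \<and> tp L M A I y = tp L M A I x"
    by (auto simp: realizes_def tp_eq_iff)
next
  assume *: "y ` I \<subseteq> carrier M \<and> tp L M A I y = tp L M A I x"
  then have "tp L M A I x = tp L M A I y" by simp
  with * show "realizes M I y (tp L M A I x)" by (auto simp: realizes_def tp_def)
qed

lemma small_Un:
  assumes "Cinfinite \<chi>" "small C \<chi> A" "small C \<chi> B"
  shows "small C \<chi> (A \<union> B)"
  using assms card_of_Un_ordLess_infinite_Field[of \<chi> A B] by (auto simp: small_def cinfinite_def)

lemma small_subset: "small C \<chi> A \<Longrightarrow> B \<subseteq> A \<Longrightarrow> small C \<chi> B"
  unfolding small_def by (auto intro: ordLeq_ordLess_trans[OF card_of_mono1])

text \<open>Strong homogeneity, which speaks of sets enumerated by themselves and of types over the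
  empty set, gives it for tuples and over a small set.\<close>

lemma monster_conjugate:
  assumes mon: "monster_model L T C \<chi>"
    and A: "small C \<chi> A" and xJ: "small C \<chi> (x ` J)" and yJ: "y ` J \<subseteq> carrier C"
    and eq: "tp L C A J y = tp L C A J x"
  obtains \<sigma> where "\<sigma> \<in> Aut L C" "\<And>a. a \<in> A \<Longrightarrow> \<sigma> a = a" "\<And>j. j \<in> J \<Longrightarrow> \<sigma> (x j) = y j"
proof -
  define D where "D = A \<union> x ` J"
  \<comment> \<open>An element of \<open>A\<close> stands for itself even when it is also an entry of \<open>x\<close>; repeated entries
    do no harm, since \<open>y\<close> satisfies the same equalities as \<open>x\<close>.\<close>
  define r where "r d = (if d \<in> A then Inl d else Inr (SOME j. j \<in> J \<and> x j = d))" for d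
  define f where "f d = case_sum id y (r d)" for d
  have D: "small C \<chi> D"
    unfolding D_def using mon A xJ by (intro small_Un) (auto simp: monster_model_def)
  have r: "r d \<in> A <+> J \<and> case_sum id x (r d) = d" if "d \<in> D" for d
  proof (cases "d \<in> A")
    case False
    then have "\<exists>j. j \<in> J \<and> x j = d" using that by (auto simp: D_def)
    from someI_ex[OF this] show ?thesis using False by (auto simp: r_def)
  qed (auto simp: r_def)
  have "tp L C {} D f = tp L C {} D (\<lambda>d. case_sum id x (r d))"
    unfolding f_def using r by (intro tp_eq_transfer[OF eq]) auto
  also have "\<dots> = tp L C {} D id"
    using r by (intro tp_cong) auto
  finally have tp: "tp L C {} D f = tp L C {} D id" .
  have fA: "f a = a" if "a \<in> A" for a using that by (simp add: f_def r_def)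
  have fx: "f (x j) = y j" if "j \<in> J" for j
  proof -
    have "x j \<in> D" using that by (simp add: D_def)
    with r have "r (x j) \<in> A <+> J" "case_sum id x (r (x j)) = case_sum id x (Inr j)" by auto
    then have "case_sum id y (r (x j)) = case_sum id y (Inr j)"
      using that by (intro tp_eq_same_equalities[OF eq[symmetric]]) auto
    then show ?thesis by (simp add: f_def)
  qed
  have "f ` D \<subseteq> carrier C" using fA fx A yJ by (auto simp: D_def small_def)
  with D tp obtain \<sigma> where "\<sigma> \<in> Aut L C" "\<forall>d\<in>D. \<sigma> d = f d"
    using mon unfolding monster_model_def strongly_homogeneous_def by blast
  with fA fx that show ?thesis by (simp add: D_def)
qed

section \<open>Independence\<close>

context
  fixes L :: "('f, 'r) language" and C :: "('f, 'r, 'a) struct" and \<chi> :: "'m rel"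
    and ind :: "'a set \<Rightarrow> 'a set \<Rightarrow> 'a set \<Rightarrow> bool"
  assumes ind: "independence_relation L C \<chi> ind"
begin

lemma ind_invariant:
  assumes "small C \<chi> X" "small C \<chi> B" "small C \<chi> D" "ind X B D" "\<sigma> \<in> Aut L C"
  shows "ind (\<sigma> ` X) (\<sigma> ` B) (\<sigma> ` D)"
  by (rule ind[unfolded independence_relation_def, THEN conjunct1, rule_format, OF assms])

lemma ind_normal:
  assumes "small C \<chi> X" "small C \<chi> B" "small C \<chi> D" "ind X B D"
  shows "ind (X \<union> B) B D"
  by (rule ind[unfolded independence_relation_def, THEN conjunct2, THEN conjunct1, rule_format,
        OF assms])

lemma ind_sym:
  assumes "small C \<chi> X" "small C \<chi> B" "small C \<chi> D" "ind X B D"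
  shows "ind D B X"
  by (rule ind[unfolded independence_relation_def, THEN conjunct2, THEN conjunct2, THEN conjunct1,
        rule_format, OF assms])

lemma ind_base_mono:
  assumes "small C \<chi> X" "small C \<chi> E" "B \<subseteq> D" "D \<subseteq> E" "ind X B E"
  shows "ind X D E"
proof -
  have D: "small C \<chi> D" by (rule small_subset[OF assms(2,4)])
  have B: "small C \<chi> B" by (rule small_subset[OF D assms(3)])
  show ?thesis
    using ind[unfolded independence_relation_def, THEN conjunct2, THEN conjunct2, THEN conjunct2,
        THEN conjunct1, rule_format, OF assms(1) B D assms(2-4)] assms(5) by simp
qed

lemma ind_mono:
  assumes "small C \<chi> X" "small C \<chi> B" "small C \<chi> D" "ind X B D" "Y \<subseteq> X"
  shows "ind Y B D"
proof -
  have fin: "ind Z B D \<longleftrightarrow> (\<forall>Z0. Z0 \<subseteq> Z \<longrightarrow> finite Z0 \<longrightarrow> ind Z0 B D)" if "small C \<chi> Z" for Z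
    by (rule ind[unfolded independence_relation_def, THEN conjunct2, THEN conjunct2,
        THEN conjunct2, THEN conjunct2, THEN conjunct1, rule_format, OF that assms(2,3)])
  have "\<forall>Z0. Z0 \<subseteq> X \<longrightarrow> finite Z0 \<longrightarrow> ind Z0 B D" using fin[OF assms(1)] assms(4) by simp
  then show ?thesis using fin[OF small_subset[OF assms(1,5)]] assms(5) by simp
qed

text \<open>Part of the left-hand side may be moved into the base and into the right-hand side.\<close>

lemma ind_move_to_base:
  assumes \<chi>: "Cinfinite \<chi>" and small: "small C \<chi> X" "small C \<chi> Y" "small C \<chi> D"
    and BD: "B \<subseteq> D" and XY: "ind (X \<union> Y) B D"
  shows "ind X (B \<union> Y) (D \<union> Y)"
proof -
  have B: "small C \<chi> B" by (rule small_subset[OF small(3) BD])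
  have XYB: "small C \<chi> (X \<union> Y \<union> B)" and BY: "small C \<chi> (B \<union> Y)"
    and DBY: "small C \<chi> (D \<union> (B \<union> Y))"
    by (intro small_Un[OF \<chi>] small B)+
  have "ind (X \<union> Y \<union> B) B D" by (rule ind_normal[OF small_Un[OF \<chi> small(1,2)] B small(3) XY])
  then have "ind D B (X \<union> Y \<union> B)" by (rule ind_sym[OF XYB B small(3)])
  then have "ind D (B \<union> Y) (X \<union> Y \<union> B)"
    by (rule ind_base_mono[OF small(3) XYB, rotated 2]) auto
  then have "ind (D \<union> (B \<union> Y)) (B \<union> Y) (X \<union> Y \<union> B)" by (rule ind_normal[OF small(3) BY XYB])
  then have "ind (X \<union> Y \<union> B) (B \<union> Y) (D \<union> (B \<union> Y))" by (rule ind_sym[OF DBY BY XYB])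
  then have "ind X (B \<union> Y) (D \<union> (B \<union> Y))" by (rule ind_mono[OF XYB BY DBY]) auto
  moreover have "D \<union> (B \<union> Y) = D \<union> Y" using BD by blast
  ultimately show ?thesis by simp
qed

end

section \<open>From one variable to tuples\<close>

text \<open>One step of the recursion: a partial copy \<open>b\<close> of \<open>c\<close>, defined on \<open>J\<close> and lying in the
  predicate, extends to one more index \<open>i\<close>.\<close>

lemma density_extend:
  fixes C :: "('f, 'r, 'a) struct" and ind :: "'a set \<Rightarrow> 'a set \<Rightarrow> 'a set \<Rightarrow> bool"
  assumes mon: "monster_model L T C \<chi>" and ind: "independence_relation L C \<chi> ind"
    and \<kappa>: "Cinfinite \<kappa>" "\<kappa> <o \<chi>"
    and MC: "carrier MP \<subseteq> carrier C"
    and dens: "density_property L C ind \<kappa> MP (UNIV :: unit set)"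
    and A: "A \<subseteq> carrier MP" "|A| <o \<kappa>"
    and J: "|J| <o \<kappa>" and iJ: "i \<notin> J"
    and c: "c ` insert i J \<subseteq> carrier C" "ind (c ` insert i J) (P_of MP \<inter> A) A"
    and b: "b ` J \<subseteq> P_of MP" "tp L C A J b = tp L C A J c"
  shows "\<exists>x \<in> P_of MP. tp L C A (insert i J) (b(i := x)) = tp L C A (insert i J) c"
proof -
  have \<chi>: "Cinfinite \<chi>" and str: "is_struct L C" using mon by (auto simp: monster_model_def)
  have PM: "P_of MP \<subseteq> carrier MP" by (auto simp: P_of_def)
  have cardJ: "|f ` J| <o \<kappa>" for f :: "_ \<Rightarrow> 'a"
    by (rule ordLeq_ordLess_trans[OF card_of_image J])
  have sub_small: "small C \<chi> X" if "X \<subseteq> carrier C" "|X| <o \<kappa>" for X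
    unfolding small_def using that(1) ordLess_transitive[OF that(2) \<kappa>(2)] by simp
  have sA: "small C \<chi> A" using A MC by (intro sub_small) auto
  have scJ: "small C \<chi> (c ` J)"
    using cardJ c(1) by (intro sub_small) auto
  have sbJ: "small C \<chi> (b ` J)"
    using cardJ b(1) PM MC by (intro sub_small) auto
  have sing: "small C \<chi> {a}" if "a \<in> carrier C" for a
  proof -
    have "Well_order \<chi>" using \<chi> card_order_on_well_order_on by blast
    then have "|{a}| <o \<chi>"
      using \<chi> by (intro finite_ordLess_infinite card_of_Well_order)
        (simp_all add: cinfinite_def Field_card_of)
    with that show ?thesis by (simp add: small_def)
  qed
  have bJ: "b ` J \<subseteq> carrier C" using b PM MC by blast
  obtain \<sigma> where \<sigma>: "\<sigma> \<in> Aut L C" "\<And>a. a \<in> A \<Longrightarrow> \<sigma> a = a" "\<And>j. j \<in> J \<Longrightarrow> \<sigma> (c j) = b j"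
    using monster_conjugate[OF mon sA scJ bJ b(2)] by blast
  define d where "d = \<sigma> (c i)"
  have d: "d \<in> carrier C" using \<sigma>(1) c(1) by (auto simp: d_def Aut_def bij_betw_def)
  let ?P = "P_of MP \<inter> A"
  let ?B = "A \<union> b ` J"
  have ci: "c i \<in> carrier C" using c(1) by blast
  have scI: "small C \<chi> (c ` insert i J)"
    using small_Un[OF \<chi> sing[OF ci] scJ] by simp
  have sP: "small C \<chi> ?P" using small_subset[OF sA] by blast
  have "ind (\<sigma> ` c ` insert i J) (\<sigma> ` ?P) (\<sigma> ` A)"
    by (rule ind_invariant[OF ind scI sP sA c(2) \<sigma>(1)])
  moreover have "\<sigma> ` c ` insert i J = {d} \<union> b ` J"
    using \<sigma>(3) by (force simp: d_def)
  moreover have "\<sigma> ` ?P = ?P" "\<sigma> ` A = A" using \<sigma>(2) by force+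
  ultimately have "ind ({d} \<union> b ` J) ?P A" by simp
  then have "ind {d} (?P \<union> b ` J) ?B"
    by (intro ind_move_to_base[OF ind \<chi>] sing d sbJ sA) auto
  moreover have "?P \<union> b ` J = P_of MP \<inter> ?B" using b(1) by blast
  ultimately have "ind {d} (P_of MP \<inter> ?B) ?B" by simp
  moreover
  define q where "q = tp L C ?B (UNIV :: unit set) (\<lambda>_. d)"
  have "realizes C UNIV (\<lambda>_. d) q" using d by (simp add: q_def realizes_tp_iff image_subset_iff)
  ultimately have "type_ind C ind UNIV q (P_of MP \<inter> ?B) ?B"
    unfolding type_ind_def by force
  moreover have "q \<in> complete_types L C ?B UNIV"
    unfolding q_def using d by (intro tp_in_complete_types) auto
  moreover have "?B \<subseteq> carrier MP" using A b(1) PM by blast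
  moreover have "|?B| <o \<kappa>"
    using \<kappa>(1) A(2) cardJ by (intro card_of_Un_ordLess_infinite_Field) (auto simp: cinfinite_def)
  ultimately obtain u :: "unit \<Rightarrow> 'a" where u: "u ` UNIV \<subseteq> P_of MP" "realizes C UNIV u q"
    using dens unfolding density_property_def by blast
  define x where "x = u ()"
  have ux: "u = (\<lambda>_. x)" by (simp add: x_def fun_eq_iff)
  have x: "x \<in> P_of MP" using u(1) by (auto simp: x_def)
  have eq: "tp L C ?B (UNIV :: unit set) (\<lambda>_. x) = tp L C ?B UNIV (\<lambda>_. d)"
    using u(2) by (simp add: q_def realizes_tp_iff ux)
  \<comment> \<open>The parameters \<open>b j\<close> in the type over \<open>A \<union> b ` J\<close> become entries of the tuple.\<close>
  define r :: "_ \<Rightarrow> 'a + unit" where "r j = (if j = i then Inr () else Inl (b j))" for j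
  have "tp L C A (insert i J) (\<lambda>j. case_sum id (\<lambda>_. x) (r j))
      = tp L C A (insert i J) (\<lambda>j. case_sum id (\<lambda>_. d) (r j))"
    by (rule tp_eq_transfer[OF eq, where t = Inl]) (auto simp: r_def)
  moreover have "(\<lambda>j. case_sum id (\<lambda>_. x) (r j)) = b(i := x)"
    by (auto simp: r_def)
  moreover have "tp L C A (insert i J) (\<lambda>j. case_sum id (\<lambda>_. d) (r j))
      = tp L C A (insert i J) (\<lambda>j. \<sigma> (c j))"
    using \<sigma>(3) by (intro tp_cong) (auto simp: r_def d_def)
  moreover have "\<dots> = tp L C A (insert i J) c"
    using sA \<sigma> c(1) by (intro tp_Aut[OF str]) (auto simp: small_def)
  ultimately show ?thesis using x by auto
qed

theorem lemma5p1:
  fixes L :: "('f, 'r) language"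
    and T :: "('f, 'r, nat) fm set"
    and C :: "('f, 'r, 'a) struct"
    and \<chi> :: "'m rel"
    and ind :: "'a set \<Rightarrow> 'a set \<Rightarrow> 'a set \<Rightarrow> bool"
    and \<kappa>\<^sub>0 :: "'b rel"
    and \<kappa> :: "'k rel"
    and MP :: "('f, 'r option, 'a) struct"
    and I :: "'i set"
  assumes "complete_theory L T"
    and "monster_model L T C \<chi>"
    and "independence_relation L C \<chi> ind"
    and "is_kappa0 C \<chi> ind \<kappa>\<^sub>0"
    and "Card_order \<kappa>" and "\<kappa> <o \<chi>" and "\<kappa>\<^sub>0 <o \<kappa>" and "|T| <o \<kappa>"
    and "model2 L T C MP" and "small C \<chi> (carrier MP)"
    and "density_property L C ind \<kappa> MP (UNIV :: unit set)"
    and "|I| <o \<kappa>"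
  shows "density_property L C ind \<kappa> MP I"
  unfolding density_property_def
proof (intro allI impI)
  fix A and q :: "('f, 'r, 'a, 'i) pfm set"
  assume A: "A \<subseteq> carrier MP" "|A| <o \<kappa>" and q: "q \<in> complete_types L C A I"
    and "type_ind C ind I q (P_of MP \<inter> A) A"
  then obtain c where "realizes C I c q" and indc: "ind (c ` I) (P_of MP \<inter> A) A"
    unfolding type_ind_def by blast
  then have c: "c ` I \<subseteq> carrier C" and q_eq: "q = tp L C A I c"
    using complete_type_eq_tp[OF q] by (auto simp: realizes_def)
  have MC: "carrier MP \<subseteq> carrier C"
    using assms(9) by (simp add: model2_def elem_substruct_def reduct_def)
  have PM: "P_of MP \<subseteq> carrier MP" by (auto simp: P_of_def)
  have \<kappa>: "Cinfinite \<kappa>"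
    using assms(4,5) cinfinite_mono[OF ordLess_imp_ordLeq[OF assms(7)]]
    by (simp add: is_kappa0_def)
  have sub_small: "small C \<chi> X" if "X \<subseteq> carrier C" "|X| <o \<kappa>" for X
    unfolding small_def using that(1) ordLess_transitive[OF that(2) assms(6)] by simp
  have sA: "small C \<chi> A" using A MC by (intro sub_small) auto
  have scI: "small C \<chi> (c ` I)"
    using c by (intro sub_small ordLeq_ordLess_trans[OF card_of_image assms(12)])
  have sP: "small C \<chi> (P_of MP \<inter> A)" using small_subset[OF sA] by blast

  obtain r :: "'i rel" where r: "well_order_on UNIV r"
    using well_order_on by blast
  define R where "R = r - Id"
  have wf: "wf R" using r by (simp add: R_def well_order_on_def)
  have tot: "j = k \<or> (j, k) \<in> R \<or> (k, j) \<in> R" for j k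
    using r by (auto simp: R_def well_order_on_def linear_order_on_def total_on_def)
  define J where "J i = {j \<in> I. (j, i) \<in> R}" for i
  \<comment> \<open>A correct choice of \<open>x\<close> at stage \<open>i\<close>, given \<open>b\<close> on the indices below \<open>i\<close>\<close>
  define Q where "Q b i x \<longleftrightarrow> (i \<in> I \<longrightarrow> x \<in> P_of MP \<and>
      tp L C A (insert i (J i)) (b(i := x)) = tp L C A (insert i (J i)) c)" for b i x

  \<comment> \<open>Correct choices entail equality of types on every set of indices: a finite set of
    indices lies in the closed initial segment of its largest element.\<close>
  have union: "tp L C A K b = tp L C A K c"
    if K: "K \<subseteq> I" and Q: "\<And>j. j \<in> K \<Longrightarrow> Q b j (b j)" for K b
  proof (rule tp_eq_finitary)
    fix F assume F: "F \<subseteq> K" "finite F"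
    show "tp L C A F b = tp L C A F c"
    proof (cases "F = {}")
      case False
      have "acyclic R" using wf wf_acyclic by blast
      then have "wf ((R \<inter> F \<times> F)\<inverse>)"
        using F(2) by (intro finite_acyclic_wf_converse) (auto intro: acyclic_subset)
      from wfE_min'[OF this False] obtain m where m: "m \<in> F"
        and max: "\<And>j. (j, m) \<in> (R \<inter> F \<times> F)\<inverse> \<Longrightarrow> j \<notin> F"
        by metis
      have "j = m \<or> (j, m) \<in> R" if "j \<in> F" for j
        using max[of j] m that tot[of j m] by auto
      then have "F \<subseteq> insert m (J m)"
        using F(1) K by (auto simp: J_def)
      moreover have "tp L C A (insert m (J m)) b = tp L C A (insert m (J m)) c"
        using Q[of m] m F(1) K by (auto simp: Q_def)
      ultimately show ?thesis using tp_eq_mono by blast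
    next
      case True
      then show ?thesis by (intro tp_cong) simp
    qed
  qed

  have "\<exists>b. \<forall>i. Q b i (b i)"
  proof (rule dependent_wf_choice[OF wf])
    fix f g :: "'i \<Rightarrow> 'a" and i x
    assume "\<And>z. (z, i) \<in> R \<Longrightarrow> f z = g z"
    then have "tp L C A (insert i (J i)) (f(i := x)) = tp L C A (insert i (J i)) (g(i := x))"
      by (intro tp_cong) (auto simp: J_def)
    then show "Q f i x = Q g i x" by (simp add: Q_def)
  next
    fix i b assume Q: "\<And>j. (j, i) \<in> R \<Longrightarrow> Q b j (b j)"
    show "\<exists>x. Q b i x"
    proof (cases "i \<in> I")
      case True
      have JI: "insert i (J i) \<subseteq> I" using True by (auto simp: J_def)
      have "\<exists>x \<in> P_of MP. tp L C A (insert i (J i)) (b(i := x)) = tp L C A (insert i (J i)) c"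
      proof (rule density_extend[OF assms(2,3) \<kappa> assms(6) MC assms(11) A])
        show "|J i| <o \<kappa>"
          using JI by (intro ordLeq_ordLess_trans[OF card_of_mono1 assms(12)]) simp
        show "i \<notin> J i" by (simp add: J_def R_def)
        show "c ` insert i (J i) \<subseteq> carrier C" using c JI by blast
        show "ind (c ` insert i (J i)) (P_of MP \<inter> A) A"
          by (rule ind_mono[OF assms(3) scI sP sA indc]) (use JI in blast)
        show "b ` J i \<subseteq> P_of MP" using Q by (auto simp: J_def Q_def)
        show "tp L C A (J i) b = tp L C A (J i) c"
          using Q by (intro union) (auto simp: J_def)
      qed
      then show ?thesis by (auto simp: Q_def)
    qed (simp add: Q_def)
  qed
  then obtain b where b: "\<And>i. Q b i (b i)" by blast
  then have bP: "b ` I \<subseteq> P_of MP" by (auto simp: Q_def)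
  moreover have "realizes C I b q"
    unfolding q_eq realizes_tp_iff
  proof
    show "b ` I \<subseteq> carrier C" using bP PM MC by blast
    show "tp L C A I b = tp L C A I c" by (rule union) (use b in simp_all)
  qed
  ultimately show "\<exists>c. c ` I \<subseteq> P_of MP \<and> realizes C I c q" by blast
qed

end
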